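(* Let $S,T$ be nonempty subsets of $[n-1]$ such that $A=T_n\langle S;T\rangle$ is a walk-ensured Toeplitz matrix. Then the matrix period of $A$ is $\gcd(S+T)/\gcd(S\cup T)$. Furthermore, if $\gcd(S+T)\le n$, then the graph sequence $\{C^m(D(A))\}_{m=1}^\infty$ converges (i.e., is eventually constant).
   Context: Matrices are Boolean ($0,1$ entries with $1+1=1$), and powers are Boolean matrix powers. For nonempty $S,T\subseteq[n-1]$, $T_n\langle S;T\rangle$ denotes the $n\times n$ $(0,1)$-matrix whose $(i,j)$-entry is $1$ if and only if $j-i\in S$ or $i-j\in T$. Its digraph $D(A)$ has vertex set $[n]$ and an arc $(i,j)$ exactly when the $(i,j)$-entry is $1$. $\gcd(S\cup T)$ is the gcd of all elements of $S\cup T$; $\gcd(S+T)=\gcd\{s+t: s\in S,t\in T\}$; $s_1=\min S$. The matrix $A$ is called walk-ensured if there is a positive integer $M$ such that for all vertices $u,v\in[n]$ and every integer $\ell\ge M$ with $v-u\equiv \ell s_1 \pmod{\gcd(S+T)}$, there is a directed walk from $u$ to $v$ of length $\ell$ in $D(A)$. The matrix period of a Boolean square matrix $A$ is the smallest positive integer $p$ for which there is $M$ with $A^m=A^{m+p}$ for all $m\ge M$. For a digraph $D$ and positive integer $m$, the $m$-step competition graph $C^m(D)$ is the (undirected) graph on $V(D)$ in which distinct vertices $x,y$ are adjacent if and only if there is a vertex $z$ such that $D$ has a directed walk of length $m$ from $x$ to $z$ and one of length $m$ from $y$ to $z$. *)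

theory Defs
  imports
    "Jordan_Normal_Form.Matrix"
    "Graph_Theory.Pair_Digraph"
    "HOL-Number_Theory.Cong"
begin

text \<open>
  The Boolean semiring: \<open>0 = False\<close>, \<open>1 = True\<close>, addition is disjunction (so \<open>1 + 1 = 1\<close>) and
  multiplication is conjunction. With this instance, the matrix product and matrix power
  of \<open>bool mat\<close> are the Boolean ones.
\<close>

instantiation bool :: comm_semiring_1
begin

definition zero_bool :: bool where "0 = False"
definition one_bool :: bool where "1 = True"
definition plus_bool :: "bool \<Rightarrow> bool \<Rightarrow> bool" where "a + b = (a \<or> b)"
definition times_bool :: "bool \<Rightarrow> bool \<Rightarrow> bool" where "a * b = (a \<and> b)"

instance
  by standard (auto simp: zero_bool_def one_bool_def plus_bool_def times_bool_def)

end

text \<open>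
  Library matrices are indexed from 0, so the \<open>(i, j)\<close>-entry in the usual 1-based numbering is
  \<open>A $$ (i - 1, j - 1)\<close>. The Toeplitz entries only depend on the difference of the indices, which
  is why no shift is visible in the next definition. The equations \<open>j = i + s\<close> and \<open>i = j + t\<close>
  avoid truncated subtraction.
\<close>

definition toeplitz :: "nat \<Rightarrow> nat set \<Rightarrow> nat set \<Rightarrow> bool mat" where
  "toeplitz n S T = mat n n (\<lambda>(i, j).
     if (\<exists>s\<in>S. j = i + s) \<or> (\<exists>t\<in>T. i = j + t) then 1 else 0)"

definition matrix_digraph :: "bool mat \<Rightarrow> nat pair_pre_digraph" where
  "matrix_digraph A = \<lparr> pverts = {1..dim_row A},
     parcs = {(i, j). i \<in> {1..dim_row A} \<and> j \<in> {1..dim_row A} \<and> A $$ (i - 1, j - 1) = 1} \<rparr>"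

definition has_walk :: "('a, 'b) pre_digraph \<Rightarrow> nat \<Rightarrow> 'a \<Rightarrow> 'a \<Rightarrow> bool" where
  "has_walk D m u v \<longleftrightarrow> (\<exists>p. pre_digraph.awalk D u p v \<and> length p = m)"

definition gcd_union :: "nat set \<Rightarrow> nat set \<Rightarrow> nat" where
  "gcd_union S T = Gcd (S \<union> T)"

definition gcd_sumset :: "nat set \<Rightarrow> nat set \<Rightarrow> nat" where
  "gcd_sumset S T = Gcd {s + t | s t. s \<in> S \<and> t \<in> T}"

definition walk_ensured :: "nat \<Rightarrow> nat set \<Rightarrow> nat set \<Rightarrow> bool" where
  "walk_ensured n S T \<longleftrightarrow> (\<exists>M>0. \<forall>u\<in>{1..n}. \<forall>v\<in>{1..n}. \<forall>l\<ge>M.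
     [int v - int u = int l * int (Min S)] (mod int (gcd_sumset S T)) \<longrightarrow>
     has_walk (matrix_digraph (toeplitz n S T)) l u v)"

definition matrix_period :: "bool mat \<Rightarrow> nat" where
  "matrix_period A = (LEAST p. p > 0 \<and> (\<exists>M. \<forall>m\<ge>M. A ^\<^sub>m m = A ^\<^sub>m (m + p)))"

text \<open>An undirected graph is given by its vertex set and its set of two-element edges.\<close>

definition competition_graph ::
    "nat \<Rightarrow> ('a, 'b) pre_digraph \<Rightarrow> 'a set \<times> 'a set set" where
  "competition_graph m D = (verts D,
     {{x, y} | x y. x \<in> verts D \<and> y \<in> verts D \<and> x \<noteq> y \<and>
        (\<exists>z\<in>verts D. has_walk D m x z \<and> has_walk D m y z)})"

end

theory Submission
  imports Defs
begin

text \<open>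
  Modulo \<open>g = gcd (S + T)\<close> every \<open>s \<in> S\<close> and every \<open>- t\<close> with \<open>t \<in> T\<close> is congruent to
  \<open>s\<^sub>1 = min S\<close>, so a walk of length \<open>l\<close> from \<open>u\<close> to \<open>v\<close> forces \<open>v - u \<equiv> l s\<^sub>1 (mod g)\<close>. For a
  walk-ensured matrix this condition is also sufficient once \<open>l\<close> is large. Hence
  the powers eventually repeat with step \<open>p\<close> exactly when \<open>g\<close> divides \<open>p s\<^sub>1\<close>, i.e. when
  \<open>g / gcd (g, s\<^sub>1)\<close> divides \<open>p\<close>, and \<open>gcd (g, s\<^sub>1) = gcd (S \<union> T)\<close>. If \<open>g \<le> n\<close>, the vertices
  cover all residues modulo \<open>g\<close>, so for large \<open>m\<close> two vertices have a common \<open>m\<close>-step prey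
  exactly when they are congruent modulo \<open>g\<close>.
\<close>

section \<open>Boolean matrix powers and directed walks\<close>

lemma sum_bool_iff:
  fixes f :: "'a \<Rightarrow> bool"
  assumes "finite A"
  shows "sum f A \<longleftrightarrow> (\<exists>x\<in>A. f x)"
  using assms by (induction A rule: finite_induct) (auto simp: zero_bool_def plus_bool_def)

lemma bool_mat_mult_index:
  fixes A B :: "bool mat"
  assumes "A \<in> carrier_mat n m" "B \<in> carrier_mat m k" "i < n" "j < k"
  shows "(A * B) $$ (i, j) \<longleftrightarrow> (\<exists>l<m. A $$ (i, l) \<and> B $$ (l, j))"
  using assms by (auto simp: scalar_prod_def sum_bool_iff times_bool_def)

text \<open>The last arc is split off, not the first, to match the recursion of
  \<open>pow_mat\<close>, which multiplies by the matrix on the right.\<close>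

lemma (in pair_wf_digraph) has_walk_Suc_iff:
  "has_walk (with_proj G) (Suc m) u v \<longleftrightarrow>
     (\<exists>w. has_walk (with_proj G) m u w \<and> (w, v) \<in> parcs G)"
proof
  assume "has_walk (with_proj G) (Suc m) u v"
  then obtain p where "awalk u p v" "length p = Suc m"
    by (auto simp: has_walk_def)
  then obtain q e where "awalk u (q @ [e]) v" "length q = m"
    by (auto simp: length_Suc_conv_rev)
  then have "awalk u q (awlast u q)" "e = (awlast u q, v)" "e \<in> parcs G"
    by (cases e; auto simp: awalk_simps)+
  with \<open>length q = m\<close> show "\<exists>w. has_walk (with_proj G) m u w \<and> (w, v) \<in> parcs G"
    by (auto simp: has_walk_def)
next
  assume "\<exists>w. has_walk (with_proj G) m u w \<and> (w, v) \<in> parcs G"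
  then obtain w p where p: "awalk u p w" "length p = m" and arc: "(w, v) \<in> parcs G"
    by (auto simp: has_walk_def)
  from arc have "awalk w [(w, v)] v"
    using arc_snd_in_verts[OF arc] by (simp add: awalk_simps)
  with p(1) have "awalk u (p @ [(w, v)]) v"
    by (rule awalk_appendI)
  with p(2) show "has_walk (with_proj G) (Suc m) u v"
    by (auto simp: has_walk_def intro!: exI[of _ "p @ [(w, v)]"])
qed

lemma has_walk_0_iff: "has_walk D 0 u v \<longleftrightarrow> u \<in> verts D \<and> u = v"
  by (auto simp: has_walk_def pre_digraph.awalk_def pre_digraph.cas.simps)

lemma matrix_digraph_wf: "pair_wf_digraph (matrix_digraph A)"
  by unfold_locales (auto simp: matrix_digraph_def)

lemma pverts_matrix_digraph: "pverts (matrix_digraph A) = {1..dim_row A}"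
  by (simp add: matrix_digraph_def)

lemma matrix_digraph_arc_iff:
  "(u, v) \<in> parcs (matrix_digraph A) \<longleftrightarrow>
     u \<in> {1..dim_row A} \<and> v \<in> {1..dim_row A} \<and> A $$ (u - 1, v - 1)"
  by (auto simp: matrix_digraph_def one_bool_def)

text \<open>By induction on \<open>m\<close>: one more factor \<open>A\<close> appends one more arc.
  \<open>Suc\<close> translates matrix indices, which start at 0, into vertices, which start at
  1.\<close>

lemma pow_mat_index_iff_has_walk:
  fixes A :: "bool mat"
  assumes A: "A \<in> carrier_mat n n" and "i < n" "j < n"
  shows "(A ^\<^sub>m m) $$ (i, j) \<longleftrightarrow> has_walk (matrix_digraph A) m (Suc i) (Suc j)"
  using \<open>j < n\<close>
proof (induction m arbitrary: j)
  case 0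
  then show ?case
    using A \<open>i < n\<close>
    by (auto simp: has_walk_0_iff pverts_matrix_digraph zero_bool_def one_bool_def)
next
  case (Suc m)
  let ?D = "matrix_digraph A"
  have "(A ^\<^sub>m Suc m) $$ (i, j) \<longleftrightarrow> (\<exists>l<n. (A ^\<^sub>m m) $$ (i, l) \<and> A $$ (l, j))"
    unfolding pow_mat.simps
    using A \<open>i < n\<close> Suc.prems by (intro bool_mat_mult_index pow_carrier_mat) auto
  also have "\<dots> \<longleftrightarrow> (\<exists>l<n. has_walk ?D m (Suc i) (Suc l) \<and> (Suc l, Suc j) \<in> parcs ?D)"
    using Suc A by (auto simp: matrix_digraph_arc_iff)
  also have "\<dots> \<longleftrightarrow> (\<exists>w. has_walk ?D m (Suc i) w \<and> (w, Suc j) \<in> parcs ?D)"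
  proof
    assume "\<exists>w. has_walk ?D m (Suc i) w \<and> (w, Suc j) \<in> parcs ?D"
    then obtain w where w: "has_walk ?D m (Suc i) w" "(w, Suc j) \<in> parcs ?D" by blast
    \<comment> \<open>The arc leaving \<open>w\<close> forces \<open>w\<close> into
      \<open>{1..n}\<close>, so the subtraction is not truncated and \<open>w - 1\<close> is a valid
      index.\<close>
    then have "w - 1 < n" "w = Suc (w - 1)"
      using A by (auto simp: matrix_digraph_arc_iff)
    with w show "\<exists>l<n. has_walk ?D m (Suc i) (Suc l) \<and> (Suc l, Suc j) \<in> parcs ?D"
      by metis
  qed blast
  also have "\<dots> \<longleftrightarrow> has_walk ?D (Suc m) (Suc i) (Suc j)"
    by (rule pair_wf_digraph.has_walk_Suc_iff[OF matrix_digraph_wf, symmetric])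
  finally show ?case .
qed

section \<open>Residues of walks in the Toeplitz digraph\<close>

lemma toeplitz_carrier: "toeplitz n S T \<in> carrier_mat n n"
  by (simp add: toeplitz_def)

lemma toeplitz_digraph_arc_iff:
  "(u, v) \<in> parcs (matrix_digraph (toeplitz n S T)) \<longleftrightarrow>
     u \<in> {1..n} \<and> v \<in> {1..n} \<and> ((\<exists>s\<in>S. v = u + s) \<or> (\<exists>t\<in>T. u = v + t))"
  by (cases u; cases v)
    (auto simp: matrix_digraph_arc_iff toeplitz_def zero_bool_def one_bool_def)

lemma gcd_sumset_dvd: "s \<in> S \<Longrightarrow> t \<in> T \<Longrightarrow> gcd_sumset S T dvd s + t"
  unfolding gcd_sumset_def by (rule Gcd_dvd) blast

lemma gcd_sumset_pos:
  assumes "S \<noteq> {}" "T \<noteq> {}" "0 \<notin> S"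
  shows "gcd_sumset S T > 0"
proof -
  obtain s t where "s \<in> S" "t \<in> T" using assms by blast
  with gcd_sumset_dvd[OF this] \<open>0 \<notin> S\<close> show ?thesis
    by (metis add_is_0 dvd_0_left_iff gr0I)
qed

text \<open>A common divisor of \<open>s\<close> and all sums divides every \<open>b\<close> in
  \<open>T\<close>, because it divides \<open>s + b\<close>; with one such \<open>b\<close> it then
  divides every \<open>a\<close> in \<open>S\<close>. The choice of \<open>s\<close> in
  \<open>S\<close> is immaterial.\<close>

lemma gcd_sumset_element:
  assumes "s \<in> S" "T \<noteq> {}"
  shows "gcd (gcd_sumset S T) s = gcd_union S T"
proof (rule dvd_antisym)
  let ?h = "gcd (gcd_sumset S T) s"
  have dvd_sum: "?h dvd a + b" if "a \<in> S" "b \<in> T" for a b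
    using gcd_sumset_dvd[OF that] by (meson dvd_trans gcd_dvd1)
  have T: "?h dvd b" if "b \<in> T" for b
    using dvd_sum[OF \<open>s \<in> S\<close> that] by (simp add: dvd_add_right_iff)
  have S: "?h dvd a" if "a \<in> S" for a
    using dvd_sum[OF that] T \<open>T \<noteq> {}\<close> by (metis dvd_add_left_iff ex_in_conv)
  show "?h dvd gcd_union S T"
    unfolding gcd_union_def using S T by (auto intro!: Gcd_greatest)
  have "gcd_union S T dvd a" if "a \<in> S \<union> T" for a
    unfolding gcd_union_def using that by (rule Gcd_dvd)
  then show "gcd_union S T dvd ?h"
    using \<open>s \<in> S\<close> unfolding gcd_sumset_def by (auto intro!: Gcd_greatest)
qed

text \<open>A forward arc of length \<open>a\<close> differs from \<open>s\<close> by
  \<open>(a + b) - (s + b)\<close> for any \<open>b\<close> in \<open>T\<close>, a backward arc of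
  length \<open>b\<close> by \<open>- (s + b)\<close>; both are built from sums that the gcd
  divides.\<close>

lemma toeplitz_arc_cong:
  assumes arc: "(u, v) \<in> parcs (matrix_digraph (toeplitz n S T))"
    and "s \<in> S" "T \<noteq> {}"
  shows "[int v - int u = int s] (mod int (gcd_sumset S T))"
proof -
  let ?g = "int (gcd_sumset S T)"
  have sum: "?g dvd int a + int b" if "a \<in> S" "b \<in> T" for a b
    using gcd_sumset_dvd[OF that] by (metis int_dvd_int_iff of_nat_add)
  from arc consider a where "a \<in> S" "v = u + a" | b where "b \<in> T" "u = v + b"
    by (auto simp: toeplitz_digraph_arc_iff)
  then show ?thesis
  proof cases
    case 1
    obtain b where "b \<in> T" using \<open>T \<noteq> {}\<close> by blast
    with 1 have "?g dvd (int a + int b) - (int s + int b)"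
      using sum \<open>s \<in> S\<close> by (blast intro: dvd_diff)
    with 1 show ?thesis by (simp add: cong_iff_dvd_diff)
  next
    case 2
    then have "?g dvd - (int s + int b)"
      using sum[OF \<open>s \<in> S\<close>] by (simp only: dvd_minus_iff)
    moreover have "int v - int u - int s = - (int s + int b)"
      using 2 by simp
    ultimately show ?thesis by (simp only: cong_iff_dvd_diff)
  qed
qed

lemma toeplitz_walk_cong:
  assumes "has_walk (matrix_digraph (toeplitz n S T)) l u v" "s \<in> S" "T \<noteq> {}"
  shows "[int v - int u = int l * int s] (mod int (gcd_sumset S T))"
  using assms(1)
proof (induction l arbitrary: v)
  case 0
  then show ?case by (simp add: has_walk_0_iff)
next
  case (Suc l)
  then obtain w where "has_walk (matrix_digraph (toeplitz n S T)) l u w"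
    and arc: "(w, v) \<in> parcs (matrix_digraph (toeplitz n S T))"
    by (auto simp: pair_wf_digraph.has_walk_Suc_iff[OF matrix_digraph_wf])
  with Suc.IH have "[int w - int u = int l * int s] (mod int (gcd_sumset S T))"
    by blast
  from cong_add[OF this toeplitz_arc_cong[OF arc assms(2,3)]] show ?case
    by (simp add: algebra_simps)
qed

text \<open>Necessity holds for every length, since each arc contributes the same residue; only
  sufficiency needs the threshold from \<open>walk_ensured\<close>. From here on, long walks are
  pure arithmetic.\<close>

lemma walk_ensured_has_walk_iff:
  assumes "S \<noteq> {}" "finite S" "T \<noteq> {}" "walk_ensured n S T"
  obtains M where "\<And>l u v. \<lbrakk>l \<ge> M; u \<in> {1..n}; v \<in> {1..n}\<rbrakk> \<Longrightarrow>
    has_walk (matrix_digraph (toeplitz n S T)) l u v \<longleftrightarrow>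
      [int v - int u = int l * int (Min S)] (mod int (gcd_sumset S T))"
  using assms toeplitz_walk_cong[OF _ Min_in[OF \<open>finite S\<close> \<open>S \<noteq> {}\<close>] \<open>T \<noteq> {}\<close>]
  unfolding walk_ensured_def by metis

section \<open>Divisibility and shifted congruences\<close>

lemma dvd_mult_iff_div_gcd_dvd:
  fixes g p s :: nat
  assumes "g > 0"
  shows "g dvd p * s \<longleftrightarrow> g div gcd g s dvd p"
proof -
  let ?d = "gcd g s"
  have "?d > 0" using assms by simp
  have "g dvd p * s \<longleftrightarrow> (g div ?d) * ?d dvd (p * (s div ?d)) * ?d"
    by (simp add: mult.assoc)
  also have "\<dots> \<longleftrightarrow> g div ?d dvd p * (s div ?d)"
    using \<open>?d > 0\<close> by (simp only: dvd_times_right_cancel_iff neq0_conv)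
  also have "\<dots> \<longleftrightarrow> g div ?d dvd p"
    using assms by (intro coprime_dvd_mult_left_iff div_gcd_coprime) simp
  finally show ?thesis .
qed

text \<open>Applied with \<open>c\<close> equal to \<open>p * s\<close>, this compares the walk
  conditions for lengths \<open>m\<close> and \<open>m + p\<close>.\<close>

lemma cong_shift_iff:
  fixes a b c g :: int
  assumes "g dvd c"
  shows "[a = b] (mod g) \<longleftrightarrow> [a = b + c] (mod g)"
proof -
  have "a - (b + c) = (a - b) - c" by simp
  with assms show ?thesis
    by (metis cong_iff_dvd_diff dvd_diff_left_iff)
qed

theorem theorem4p1:
  fixes n :: nat and S T :: "nat set"
  assumes "S \<noteq> {}" and "S \<subseteq> {1..n - 1}"
    and "T \<noteq> {}" and "T \<subseteq> {1..n - 1}"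
    and "walk_ensured n S T"
  shows "real (matrix_period (toeplitz n S T)) = real (gcd_sumset S T) / real (gcd_union S T)
    \<and> (gcd_sumset S T \<le> n \<longrightarrow>
        (\<exists>G. \<forall>\<^sub>F m in sequentially.
          competition_graph m (with_proj (matrix_digraph (toeplitz n S T))) = G))"
proof -
  let ?A = "toeplitz n S T"
  let ?D = "matrix_digraph ?A"
  define g where "g = gcd_sumset S T"
  define s where "s = Min S"
  have "finite S" using \<open>S \<subseteq> {1..n - 1}\<close> finite_subset by blast
  have "s \<in> S" unfolding s_def using \<open>finite S\<close> \<open>S \<noteq> {}\<close> by (rule Min_in)
  have "0 \<notin> S" using \<open>S \<subseteq> {1..n - 1}\<close> by auto
  have "g > 0"
    unfolding g_def using \<open>S \<noteq> {}\<close> \<open>T \<noteq> {}\<close> \<open>0 \<notin> S\<close> by (rule gcd_sumset_pos)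
  have "n > 0" using \<open>s \<in> S\<close> \<open>S \<subseteq> {1..n - 1}\<close> by (cases n) auto
  have gcd_eq: "gcd g s = gcd_union S T"
    unfolding g_def using \<open>s \<in> S\<close> \<open>T \<noteq> {}\<close> by (rule gcd_sumset_element)
  obtain M where walk: "\<And>l u v. \<lbrakk>l \<ge> M; u \<in> {1..n}; v \<in> {1..n}\<rbrakk> \<Longrightarrow>
      has_walk ?D l u v \<longleftrightarrow> [int v - int u = int l * int s] (mod int g)"
    using walk_ensured_has_walk_iff[OF \<open>S \<noteq> {}\<close> \<open>finite S\<close> \<open>T \<noteq> {}\<close> \<open>walk_ensured n S T\<close>]
    unfolding g_def s_def by blast
  have pow: "(?A ^\<^sub>m m) $$ (i, j) \<longleftrightarrow> [int j - int i = int m * int s] (mod int g)"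
    if "m \<ge> M" "i < n" "j < n" for m i j
    using pow_mat_index_iff_has_walk[OF toeplitz_carrier \<open>i < n\<close> \<open>j < n\<close>]
      walk[OF \<open>m \<ge> M\<close>, of "Suc i" "Suc j"] that by simp
  have dims: "dim_row (?A ^\<^sub>m m) = n" "dim_col (?A ^\<^sub>m m) = n" for m
    using carrier_matD[OF pow_carrier_mat[OF toeplitz_carrier]] by blast+
  have period_iff: "(\<exists>N. \<forall>m\<ge>N. ?A ^\<^sub>m m = ?A ^\<^sub>m (m + p)) \<longleftrightarrow> g dvd p * s" for p
  proof
    assume "\<exists>N. \<forall>m\<ge>N. ?A ^\<^sub>m m = ?A ^\<^sub>m (m + p)"
    then obtain N where N: "\<And>m. m \<ge> N \<Longrightarrow> ?A ^\<^sub>m m = ?A ^\<^sub>m (m + p)" by blast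
    \<comment> \<open>Any large multiple of \<open>g\<close> makes the diagonal entries of the power equal to 1.\<close>
    define m where "m = g * (M + N)"
    have "M + N \<le> m" using \<open>g > 0\<close> by (simp add: m_def)
    then have "m \<ge> M" "m \<ge> N" by auto
    have "(?A ^\<^sub>m m) $$ (0, 0)"
      using \<open>m \<ge> M\<close> \<open>n > 0\<close> by (simp add: pow cong_iff_dvd_diff m_def)
    then have "(?A ^\<^sub>m (m + p)) $$ (0, 0)"
      using N[OF \<open>m \<ge> N\<close>] by simp
    then have "int g dvd int (m + p) * int s"
      using \<open>m \<ge> M\<close> \<open>n > 0\<close> by (simp add: pow cong_iff_dvd_diff del: of_nat_add)
    then have "g dvd (m + p) * s" by (metis int_dvd_int_iff of_nat_mult)
    \<comment> \<open>As \<open>g\<close> divides \<open>m\<close>, the divisibility leaves a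
      condition on \<open>p * s\<close> alone.\<close>
    moreover have "(m + p) * s = g * ((M + N) * s) + p * s"
      by (simp add: m_def algebra_simps)
    ultimately show "g dvd p * s"
      by (metis dvd_add_right_iff dvd_triv_left)
  next
    assume "g dvd p * s"
    then have "int g dvd int p * int s" by (metis int_dvd_int_iff of_nat_mult)
    then have entry: "(?A ^\<^sub>m m) $$ (i, j) \<longleftrightarrow> (?A ^\<^sub>m (m + p)) $$ (i, j)"
      if "m \<ge> M" "i < n" "j < n" for m i j
      using that cong_shift_iff[of "int g" "int p * int s" "int j - int i" "int m * int s"]
      by (simp add: pow distrib_right)
    have "?A ^\<^sub>m m = ?A ^\<^sub>m (m + p)" if "m \<ge> M" for m
    proof (rule eq_matI)
      fix i j
      assume "i < dim_row (?A ^\<^sub>m (m + p))" "j < dim_col (?A ^\<^sub>m (m + p))"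
      then show "(?A ^\<^sub>m m) $$ (i, j) = (?A ^\<^sub>m (m + p)) $$ (i, j)"
        using entry[OF \<open>m \<ge> M\<close>] by (simp only: dims)
    qed (simp_all only: dims)
    then show "\<exists>N. \<forall>m\<ge>N. ?A ^\<^sub>m m = ?A ^\<^sub>m (m + p)" by blast
  qed
  have "matrix_period ?A = (LEAST p. p > 0 \<and> g div gcd g s dvd p)"
    unfolding matrix_period_def period_iff
    using \<open>g > 0\<close> by (simp add: dvd_mult_iff_div_gcd_dvd)
  also have "\<dots> = g div gcd g s"
    using \<open>g > 0\<close> by (intro Least_equality) (auto simp: dvd_imp_le div_greater_zero_iff gcd_le1_nat)
  \<comment> \<open>The gcd divides \<open>g\<close>, so the natural-number quotient agrees with the
    real one.\<close>
  finally have period: "real (matrix_period ?A) = real g / real (gcd_union S T)"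
    by (metis gcd_eq gcd_dvd1 real_of_nat_div)
  have "\<exists>G. \<forall>\<^sub>F m in sequentially. competition_graph m (with_proj ?D) = G" if "g \<le> n"
  proof -
    have verts: "verts (with_proj ?D) = {1..n}"
      using carrier_matD(1)[OF toeplitz_carrier] by (simp add: pverts_matrix_digraph)
    have common: "(\<exists>z\<in>{1..n}. has_walk ?D m x z \<and> has_walk ?D m y z) \<longleftrightarrow> [int x = int y] (mod int g)"
      if m: "m \<ge> M" and x: "x \<in> {1..n}" and y: "y \<in> {1..n}" for m x y
    proof
      assume "\<exists>z\<in>{1..n}. has_walk ?D m x z \<and> has_walk ?D m y z"
      then obtain z where "[int z - int x = int m * int s] (mod int g)"
        "[int z - int y = int m * int s] (mod int g)"
        using walk m x y by blast
      then have "[int z - int x = int z - int y] (mod int g)"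
        by (metis cong_sym cong_trans)
      then show "[int x = int y] (mod int g)"
        by (simp add: cong_iff_dvd_diff) (metis dvd_minus_iff minus_diff_eq)
    next
      assume xy: "[int x = int y] (mod int g)"
      \<comment> \<open>The common target must be congruent to \<open>x + m * s\<close>. Subtracting
        1 before the reduction and adding it back afterwards selects the representative in
        \<open>{1..g}\<close>, which lies in \<open>{1..n}\<close> because
        \<open>g \<le> n\<close>.\<close>
      define r where "r = (int x + int m * int s - 1) mod int g"
      define z where "z = nat (r + 1)"
      have r: "0 \<le> r" "r < int g" using \<open>g > 0\<close> by (simp_all add: r_def)
      then have z: "z \<in> {1..n}" "int z = r + 1"
        using \<open>g \<le> n\<close> by (auto simp: z_def)
      have "[r = int x + int m * int s - 1] (mod int g)"
        by (simp add: r_def cong_def)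
      then have xz: "[int z - int x = int m * int s] (mod int g)"
        unfolding z(2) by (simp add: cong_iff_dvd_diff algebra_simps)
      \<comment> \<open>Adding \<open>x - y\<close>, which is 0 modulo \<open>g\<close>, replaces
        \<open>x\<close> by \<open>y\<close> in the walk condition.\<close>
      with cong_add[OF xz cong_diff[OF xy cong_refl[of "int y"]]]
      have "[int z - int y = int m * int s] (mod int g)"
        by simp
      with xz z(1) show "\<exists>z\<in>{1..n}. has_walk ?D m x z \<and> has_walk ?D m y z"
        using walk m x y by blast
    qed
    \<comment> \<open>The right-hand side is free of \<open>m\<close>: the limit graph is a disjoint
      union of cliques, one for each residue class modulo \<open>g\<close>.\<close>
    have "competition_graph m (with_proj ?D) = ({1..n},
        {{x, y} | x y. x \<in> {1..n} \<and> y \<in> {1..n} \<and> x \<noteq> y \<and> [int x = int y] (mod int g)})"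
      if "m \<ge> M" for m
      unfolding competition_graph_def verts using common[OF that] by blast
    then show ?thesis
      unfolding eventually_sequentially by blast
  qed
  with period show ?thesis by (simp add: g_def)
qed

end
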